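(* Let $G=\langle a_1,a_2,\ldots \mid \mathcal{R} \rangle$ be a countably generated recursively enumerable presentation of a locally finite just infinite group. Then the word problem for $G$ (with respect to this presentation) is decidable if and only if there exists a computable non-decreasing unbounded function $f:\mathbb N\to \mathbb N$ such that $|\langle a_1,\ldots,a_k\rangle_G|\geq f(k)$ for all $k\in\mathbb N$.
   Context: A group $G$ is just infinite if it is infinite and for every non-trivial normal subgroup $H\triangleleft G$ the quotient $G/H$ is finite. A group is locally finite if all its finitely generated subgroups are finite. A countably generated recursively enumerable presentation $\langle S\mid\mathcal R\rangle$ of a group $G$ consists of a countably infinite alphabet of generators $S=\{a_1,a_2,\ldots\}$ (formal letters indexed by the positive integers; different letters may represent equal elements of $G$, possibly trivial) and an algorithm $\mathcal R$ enumerating a set of words in $S\cup S^{-1}$, the defining relations, such that $G$ is the quotient of the free group on $S$ by the normal closure of this set. Words in $S\cup S^{-1}$ are encoded as finite words in a finite alphabet in the evident effective way. The word problem for a fixed presentation is decidable if there is an algorithm (which may depend on the presentation) that, given a word $x$ in $S\cup S^{-1}$, decides whether $x=1$ in $G$. The notation $\langle a_1,\ldots,a_k\rangle_G$ means the subgroup of $G$ generated by the elements represented by $a_1,\ldots,a_k$. Here $\mathbb N=\{1,2,3,\ldots\}$. *)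

theory Defs
  imports "HOL-Algebra.Algebra" "HOL-Library.Nat_Bijection"
begin

text \<open>Kleene's partial recursive functions. A program is run on a list of arguments of any
  length; an ill-formed application (for instance a projection out of range) is undefined.\<close>

datatype recf =
    Zero
  | Succ
  | Proj nat
  | Comp recf "recf list"
  | PrimRec recf recf
  | Mu recf

inductive recf_eval :: "recf \<Rightarrow> nat list \<Rightarrow> nat \<Rightarrow> bool" where
  eval_Zero: "recf_eval Zero xs 0"
| eval_Succ: "recf_eval Succ [x] (Suc x)"
| eval_Proj: "i < length xs \<Longrightarrow> recf_eval (Proj i) xs (xs ! i)"
| eval_Comp: "list_all2 (\<lambda>g y. recf_eval g xs y) gs ys \<Longrightarrow> recf_eval f ys z \<Longrightarrow> recf_eval (Comp f gs) xs z"
| eval_PrimRec_0: "recf_eval f xs y \<Longrightarrow> recf_eval (PrimRec f g) (0 # xs) y"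
| eval_PrimRec_Suc: "recf_eval (PrimRec f g) (n # xs) r \<Longrightarrow> recf_eval g (n # r # xs) y \<Longrightarrow>
    recf_eval (PrimRec f g) (Suc n # xs) y"
| eval_Mu: "recf_eval f (n # xs) 0 \<Longrightarrow> \<forall>m<n. \<exists>y>0. recf_eval f (m # xs) y \<Longrightarrow> recf_eval (Mu f) xs n"

inductive_cases eval_ZeroE: "recf_eval Zero xs y"
inductive_cases eval_SuccE: "recf_eval Succ xs y"
inductive_cases eval_ProjE: "recf_eval (Proj i) xs y"
inductive_cases eval_CompE: "recf_eval (Comp f gs) xs y"
inductive_cases eval_PrimRec_0E: "recf_eval (PrimRec f g) (0 # xs) y"
inductive_cases eval_PrimRec_SucE: "recf_eval (PrimRec f g) (Suc n # xs) y"
inductive_cases eval_MuE: "recf_eval (Mu f) xs y"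

lemma eval_deterministic: "recf_eval p xs y \<Longrightarrow> recf_eval p xs z \<Longrightarrow> y = z"
proof (induction arbitrary: z rule: recf_eval.induct)
  case (eval_Zero xs)
  then show ?case by (rule eval_ZeroE) simp
next
  case (eval_Succ x)
  then show ?case by (rule eval_SuccE) simp
next
  case (eval_Proj i xs)
  from eval_Proj.prems show ?case by (rule eval_ProjE) simp
next
  case (eval_Comp xs gs ys f y)
  from eval_Comp.prems obtain ys' where
    1: "list_all2 (\<lambda>g y. recf_eval g xs y) gs ys'" and 2: "recf_eval f ys' z"
    by (rule eval_CompE)
  have "ys = ys'"
    using eval_Comp.IH(1) 1 by (auto simp: list_all2_conv_all_nth intro!: nth_equalityI)
  with 2 eval_Comp.IH(2) show ?case by blast
next
  case (eval_PrimRec_0 f xs y g)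
  from eval_PrimRec_0.prems have "recf_eval f xs z" by (rule eval_PrimRec_0E)
  then show ?case by (rule eval_PrimRec_0.IH)
next
  case (eval_PrimRec_Suc f g n xs r y)
  from eval_PrimRec_Suc.prems obtain r' where
    1: "recf_eval (PrimRec f g) (n # xs) r'" and 2: "recf_eval g (n # r' # xs) z"
    by (rule eval_PrimRec_SucE)
  from eval_PrimRec_Suc.IH(1)[OF 1] 2 eval_PrimRec_Suc.IH(2) show ?case by simp
next
  case (eval_Mu f n xs)
  from eval_Mu.prems have z: "recf_eval f (z # xs) 0" "\<forall>m<z. \<exists>y>0. recf_eval f (m # xs) y"
    by (auto elim: eval_MuE)
  show ?case
  proof (cases n z rule: linorder_cases)
    case less
    with z(2) obtain y where "y > 0" "recf_eval f (n # xs) y" by blast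
    with eval_Mu.IH(1) show ?thesis by fastforce
  next
    case greater
    with eval_Mu.IH(2) obtain y where "y > 0" "\<And>v. recf_eval f (z # xs) v \<Longrightarrow> y = v" by blast
    with z(1) show ?thesis by fastforce
  qed
qed

definition computable :: "(nat \<Rightarrow> nat) \<Rightarrow> bool" where
  "computable f \<longleftrightarrow> (\<exists>p. \<forall>n. recf_eval p [n] (f n))"

text \<open>The index of a letter starts at 0: \<open>Gen i\<close> is the generator \<open>a\<close> with index \<open>i + 1\<close>
  and \<open>Inv i\<close> is its formal inverse.\<close>

datatype letter = Gen nat | Inv nat

type_synonym word = "letter list"

fun flip :: "letter \<Rightarrow> letter" where
  "flip (Gen i) = Inv i"
| "flip (Inv i) = Gen i"

fun letter_code :: "letter \<Rightarrow> nat" where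
  "letter_code (Gen i) = 2 * i"
| "letter_code (Inv i) = 2 * i + 1"

definition word_code :: "word \<Rightarrow> nat" where
  "word_code w = list_encode (map letter_code w)"

lemma bij_letter_code: "bij letter_code"
proof (rule bijI)
  show "inj letter_code"
  proof (rule injI)
    fix x y assume "letter_code x = letter_code y"
    then have "letter_code x div 2 = letter_code y div 2" "even (letter_code x) = even (letter_code y)"
      by simp_all
    then show "x = y" by (cases x; cases y) simp_all
  qed
  have "n = letter_code (if even n then Gen (n div 2) else Inv (n div 2))" for n
    by simp
  then show "surj letter_code" by (intro surjI) (rule sym)
qed

lemma bij_word_code: "bij word_code"
proof -
  have "bij (map letter_code)"
    using bij_letter_code
    by (metis bij_betw_def inj_mapI lists_UNIV lists_image)
  then have "bij (list_encode \<circ> map letter_code)"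
    using bij_list_encode by (rule bij_comp)
  then show ?thesis by (simp add: word_code_def[abs_def] comp_def)
qed

definition decidable_words :: "word set \<Rightarrow> bool" where
  "decidable_words L \<longleftrightarrow> (\<exists>f. computable f \<and> (\<forall>w. f (word_code w) = (if w \<in> L then 1 else 0)))"

text \<open>A nonempty language is enumerated by a total algorithm, possibly with repetitions; the empty
  language, which has no such enumeration, is allowed separately.\<close>

definition recursively_enumerable_words :: "word set \<Rightarrow> bool" where
  "recursively_enumerable_words L \<longleftrightarrow>
     L = {} \<or> (\<exists>f. computable f \<and> word_code ` L = range f)"

inductive free_eq :: "word \<Rightarrow> word \<Rightarrow> bool" where
  free_eq_refl: "free_eq u u"
| free_eq_sym: "free_eq u v \<Longrightarrow> free_eq v u"
| free_eq_trans: "free_eq u v \<Longrightarrow> free_eq v w \<Longrightarrow> free_eq u w"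
| free_eq_cancel: "free_eq (u @ [x, flip x] @ v) (u @ v)"

definition free_class :: "word \<Rightarrow> word set" where
  "free_class u = {v. free_eq u v}"

definition free_group :: "word set monoid" where
  "free_group = \<lparr>carrier = range free_class,
     monoid.mult = (\<lambda>A B. \<Union>u\<in>A. \<Union>v\<in>B. free_class (u @ v)),
     one = free_class []\<rparr>"

definition normal_closure :: "('a, 'b) monoid_scheme \<Rightarrow> 'a set \<Rightarrow> 'a set" where
  "normal_closure G A = \<Inter>{N. N \<lhd> G \<and> A \<subseteq> N}"

text \<open>Elements of the presented group are cosets of the normal closure of the relators;
  \<open>word_value R w\<close> is the one represented by \<open>w\<close>.\<close>

definition presented_group :: "word set \<Rightarrow> word set set monoid" where
  "presented_group R = free_group Mod normal_closure free_group (free_class ` R)"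

definition word_value :: "word set \<Rightarrow> word \<Rightarrow> word set set" where
  "word_value R w = normal_closure free_group (free_class ` R) #>\<^bsub>free_group\<^esub> free_class w"

definition word_problem_decidable :: "word set \<Rightarrow> bool" where
  "word_problem_decidable R \<longleftrightarrow>
     decidable_words {w. word_value R w = \<one>\<^bsub>presented_group R\<^esub>}"

lemma free_class_eq_iff: "free_class u = free_class v \<longleftrightarrow> free_eq u v"
proof
  assume "free_class u = free_class v"
  then have "v \<in> free_class u" by (simp add: free_class_def free_eq_refl)
  then show "free_eq u v" by (simp add: free_class_def)
next
  assume uv: "free_eq u v"
  have "free_eq u w \<longleftrightarrow> free_eq v w" for w
    using free_eq_trans[OF uv, of w] free_eq_trans[OF free_eq_sym[OF uv], of w] by iprover
  then show "free_class u = free_class v" by (simp add: free_class_def)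
qed

lemma free_eq_append: "free_eq u u' \<Longrightarrow> free_eq v v' \<Longrightarrow> free_eq (u @ v) (u' @ v')"
proof -
  have l: "free_eq (w @ u) (w @ u')" if "free_eq u u'" for w u u'
    using that
  proof induction
    case (free_eq_cancel u x v)
    show ?case using free_eq.free_eq_cancel[of "w @ u" x v] by simp
  qed (fact free_eq_refl, erule free_eq_sym, erule free_eq_trans, assumption)
  have r: "free_eq (u @ w) (u' @ w)" if "free_eq u u'" for w u u'
    using that
  proof induction
    case (free_eq_cancel u x v)
    show ?case using free_eq.free_eq_cancel[of u x "v @ w"] by simp
  qed (fact free_eq_refl, erule free_eq_sym, erule free_eq_trans, assumption)
  show "free_eq u u' \<Longrightarrow> free_eq v v' \<Longrightarrow> free_eq (u @ v) (u' @ v')"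
    using l[of v v' u] r[of u u' v'] by (metis free_eq_trans)
qed

lemma mult_free_class:
  "free_class u \<otimes>\<^bsub>free_group\<^esub> free_class v = free_class (u @ v)"
proof -
  have *: "free_class (u' @ v') = free_class (u @ v)"
    if "u' \<in> free_class u" "v' \<in> free_class v" for u' v'
  proof -
    from that have "free_eq u u'" "free_eq v v'" by (simp_all add: free_class_def)
    from free_eq_sym[OF free_eq_append[OF this]] show ?thesis
      by (simp only: free_class_eq_iff)
  qed
  have ne: "u \<in> free_class u" "v \<in> free_class v"
    by (simp_all add: free_class_def free_eq_refl)
  have "(\<Union>u'\<in>free_class u. \<Union>v'\<in>free_class v. free_class (u' @ v')) =
      (\<Union>u'\<in>free_class u. \<Union>v'\<in>free_class v. free_class (u @ v))"
    by (intro SUP_cong refl *)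
  also have "\<dots> = free_class (u @ v)" using ne by blast
  finally show ?thesis by (simp only: free_group_def monoid.simps partial_object.simps)
qed

lemma free_eq_flip: "free_eq (rev (map flip w) @ w) []"
proof (induction w)
  case (Cons x w)
  have "flip (flip x) = x" by (cases x) auto
  then have "free_eq (rev (map flip w) @ [flip x, x] @ w) (rev (map flip w) @ w)"
    using free_eq_cancel[of "rev (map flip w)" "flip x" w] by simp
  from free_eq_trans[OF this Cons] show ?case by simp
qed (simp add: free_eq_refl)

lemma group_free_group: "group free_group"
proof -
  have one: "\<one>\<^bsub>free_group\<^esub> = free_class []" and car: "carrier free_group = range free_class"
    by (simp_all add: free_group_def)
  show ?thesis
  proof (rule groupI)
    fix x assume "x \<in> carrier free_group"
    then obtain u where x: "x = free_class u" by (auto simp: car)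
    show "\<one>\<^bsub>free_group\<^esub> \<otimes>\<^bsub>free_group\<^esub> x = x" by (simp add: x one mult_free_class)
    have "free_class (rev (map flip u)) \<otimes>\<^bsub>free_group\<^esub> x = \<one>\<^bsub>free_group\<^esub>"
      by (simp add: x one mult_free_class free_class_eq_iff free_eq_flip)
    then show "\<exists>y\<in>carrier free_group. y \<otimes>\<^bsub>free_group\<^esub> x = \<one>\<^bsub>free_group\<^esub>"
      by (auto simp: car)
  next
    show "\<one>\<^bsub>free_group\<^esub> \<in> carrier free_group" by (simp add: one car)
  next
    fix x y assume "x \<in> carrier free_group" "y \<in> carrier free_group"
    then show "x \<otimes>\<^bsub>free_group\<^esub> y \<in> carrier free_group"
      unfolding car by (elim rangeE) (simp add: mult_free_class)
  next
    fix x y z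
    assume "x \<in> carrier free_group" "y \<in> carrier free_group" "z \<in> carrier free_group"
    then show "x \<otimes>\<^bsub>free_group\<^esub> y \<otimes>\<^bsub>free_group\<^esub> z =
        x \<otimes>\<^bsub>free_group\<^esub> (y \<otimes>\<^bsub>free_group\<^esub> z)"
      unfolding car by (elim rangeE) (simp add: mult_free_class)
  qed
qed

lemma (in group) normal_normal_closure:
  assumes A: "A \<subseteq> carrier G"
  shows "normal_closure G A \<lhd> G"
proof -
  have "carrier G \<lhd> G"
    by (rule normal_invI[OF subgroup_self]) (intro m_closed inv_closed)
  then have ne: "{N. N \<lhd> G \<and> A \<subseteq> N} \<noteq> {}" using A by blast
  have "subgroup (\<Inter>{N. N \<lhd> G \<and> A \<subseteq> N}) G"
    using ne by (rule subgroups_Inter[rotated]) (blast intro: normal_imp_subgroup)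
  then show ?thesis
    unfolding normal_closure_def
  proof (rule normal_invI, intro InterI)
    fix x h N
    assume "x \<in> carrier G" "h \<in> \<Inter>{N. N \<lhd> G \<and> A \<subseteq> N}" "N \<in> {N. N \<lhd> G \<and> A \<subseteq> N}"
    then show "x \<otimes> h \<otimes> inv x \<in> N"
      using normal.inv_op_closed2[of N G x h] by blast
  qed
qed

lemma group_presented_group: "group (presented_group R)"
proof -
  have "carrier free_group = range free_class" by (simp add: free_group_def)
  then have "free_class ` R \<subseteq> carrier free_group" by blast
  then have "normal_closure free_group (free_class ` R) \<lhd> free_group"
    by (rule group.normal_normal_closure[OF group_free_group])
  then show ?thesis
    unfolding presented_group_def by (rule normal.factorgroup_is_group)
qed

definition locally_finite :: "('a, 'b) monoid_scheme \<Rightarrow> bool" where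
  "locally_finite G \<longleftrightarrow> (\<forall>A. A \<subseteq> carrier G \<and> finite A \<longrightarrow> finite (generate G A))"

definition just_infinite :: "('a, 'b) monoid_scheme \<Rightarrow> bool" where
  "just_infinite G \<longleftrightarrow> infinite (carrier G) \<and>
     (\<forall>H. H \<lhd> G \<and> H \<noteq> {\<one>\<^bsub>G\<^esub>} \<longrightarrow> finite (carrier (G Mod H)))"

end

theory Submission
  imports Defs
begin

text \<open>If the word problem is decidable, let \<open>f k\<close> be the number of distinct elements among the
  first \<open>k\<close> generators; it is unbounded because a locally finite group with finitely many
  generators is finite. Conversely, triviality of a word is recursively enumerable, and given \<open>f\<close>
  so is nontriviality: if \<open>w \<noteq> 1\<close> then, the group being just infinite, its quotient by the normal
  closure of \<open>w\<close> is finite, so for some \<open>k\<close> the first \<open>k\<close> generators generate a subgroup of this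
  quotient with fewer than \<open>f k\<close> elements, and this is witnessed by a finite list of words. For
  \<open>w = 1\<close> the quotient is the group itself and no such \<open>k\<close> exists.\<close>

section \<open>Recursive functions\<close>

text \<open>Lists of a fixed length treat all arities uniformly; the values of \<open>F\<close> at
  lists of other lengths do not matter.\<close>

definition recursive :: "nat \<Rightarrow> (nat list \<Rightarrow> nat) \<Rightarrow> bool" where
  "recursive n F \<longleftrightarrow> (\<exists>p. \<forall>xs. length xs = n \<longrightarrow> recf_eval p xs (F xs))"

lemma recursiveI: "(\<And>xs. length xs = n \<Longrightarrow> recf_eval p xs (F xs)) \<Longrightarrow> recursive n F"
  unfolding recursive_def by blast

lemma recursive_cong:
  assumes "recursive n F" "\<And>xs. length xs = n \<Longrightarrow> F xs = G xs"
  shows "recursive n G"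
  using assms unfolding recursive_def by auto

lemma recursive_nth: "i < n \<Longrightarrow> recursive n (\<lambda>xs. xs ! i)"
  by (rule recursiveI[where p = "Proj i"]) (simp add: eval_Proj)

lemma recursive_comp:
  assumes "recursive (length Gs) F" "\<And>G. G \<in> set Gs \<Longrightarrow> recursive n G"
  shows "recursive n (\<lambda>xs. F (map (\<lambda>G. G xs) Gs))"
proof -
  obtain p where p: "\<And>xs. length xs = length Gs \<Longrightarrow> recf_eval p xs (F xs)"
    using assms(1) unfolding recursive_def by blast
  have "\<forall>G\<in>set Gs. \<exists>q. \<forall>xs. length xs = n \<longrightarrow> recf_eval q xs (G xs)"
    using assms(2) unfolding recursive_def by blast
  then obtain q where q: "\<And>G xs. G \<in> set Gs \<Longrightarrow> length xs = n \<Longrightarrow> recf_eval (q G) xs (G xs)"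
    by metis
  show ?thesis
  proof (rule recursiveI)
    fix xs :: "nat list" assume "length xs = n"
    then show "recf_eval (Comp p (map q Gs)) xs (F (map (\<lambda>G. G xs) Gs))"
      using p q by (intro eval_Comp[where ys = "map (\<lambda>G. G xs) Gs"]) (auto simp: list_all2_conv_all_nth)
  qed
qed

lemma recursive_comp1:
  "recursive 1 (\<lambda>xs. f (xs ! 0)) \<Longrightarrow> recursive n G \<Longrightarrow> recursive n (\<lambda>xs. f (G xs))"
  using recursive_comp[of "[G]" "\<lambda>xs. f (xs ! 0)" n] by simp

lemma recursive_comp2:
  "recursive 2 (\<lambda>xs. f (xs ! 0) (xs ! 1)) \<Longrightarrow> recursive n G \<Longrightarrow> recursive n H \<Longrightarrow>
    recursive n (\<lambda>xs. f (G xs) (H xs))"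
  using recursive_comp[of "[G, H]" "\<lambda>xs. f (xs ! 0) (xs ! 1)" n] by (auto simp: numeral_2_eq_2)

lemma recursive_Suc:
  assumes "recursive n F"
  shows "recursive n (\<lambda>xs. Suc (F xs))"
proof (rule recursive_comp1[OF _ assms])
  show "recursive 1 (\<lambda>xs. Suc (xs ! 0))"
    by (rule recursiveI[where p = Succ]) (auto simp: length_Suc_conv eval_Succ)
qed

lemma recursive_const: "recursive n (\<lambda>xs. c)"
proof (induction c)
  case 0
  show ?case by (rule recursiveI[where p = Zero]) (rule eval_Zero)
qed (rule recursive_Suc)

text \<open>\<open>PrimRec\<close> places counter and accumulator before the parameters. Phrasing
  its effect through \<open>rec_nat\<close> lets each later function be matched with an instance of
  the HOL recursor.\<close>

lemma recursive_rec_nat: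
  assumes "recursive n F" "recursive (Suc (Suc n)) G"
  shows "recursive (Suc n) (\<lambda>xs. rec_nat (F (tl xs)) (\<lambda>m r. G (m # r # tl xs)) (xs ! 0))"
proof -
  from assms obtain p q where
    p: "\<And>xs. length xs = n \<Longrightarrow> recf_eval p xs (F xs)" and
    q: "\<And>xs. length xs = Suc (Suc n) \<Longrightarrow> recf_eval q xs (G xs)"
    unfolding recursive_def by blast
  have "recf_eval (PrimRec p q) (k # xs) (rec_nat (F xs) (\<lambda>m r. G (m # r # xs)) k)"
    if "length xs = n" for k xs
  proof (induction k)
    case 0
    show ?case using p[OF that] by (simp add: eval_PrimRec_0)
  next
    case (Suc k)
    with q[of "k # _ # xs"] that show ?case by (auto intro: eval_PrimRec_Suc)
  qed
  then show ?thesis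
    by (intro recursiveI[where p = "PrimRec p q"]) (auto simp: length_Suc_conv)
qed

text \<open>\<open>Mu\<close> requires defined, positive values before the first zero:
  \<open>F\<close> is total, and minimality excludes earlier zeros.\<close>

lemma recursive_Least:
  assumes "recursive (Suc n) F" "\<And>xs. length xs = n \<Longrightarrow> \<exists>k. F (k # xs) = 0"
  shows "recursive n (\<lambda>xs. LEAST k. F (k # xs) = 0)"
proof -
  from assms(1) obtain p where p: "\<And>xs. length xs = Suc n \<Longrightarrow> recf_eval p xs (F xs)"
    unfolding recursive_def by blast
  show ?thesis
  proof (rule recursiveI)
    fix xs :: "nat list" assume xs: "length xs = n"
    then have "F ((LEAST k. F (k # xs) = 0) # xs) = 0"
      using LeastI_ex[OF assms(2)] by blast
    moreover have "F (m # xs) > 0" if "m < (LEAST k. F (k # xs) = 0)" for m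
      using not_less_Least[OF that] by simp
    ultimately show "recf_eval (Mu p) xs (LEAST k. F (k # xs) = 0)"
      using p[of "_ # xs"] xs by (intro eval_Mu) (metis length_Cons)+
  qed
qed

section \<open>Arithmetic and the components of Cantor pairs\<close>

lemma recursive_add: "recursive 2 (\<lambda>xs. xs ! 0 + xs ! 1)"
proof -
  have "recursive (Suc 1) (\<lambda>xs. rec_nat (tl xs ! 0) (\<lambda>m r. Suc ((m # r # tl xs) ! 1)) (xs ! 0))"
    by (intro recursive_rec_nat recursive_nth recursive_Suc) simp_all
  moreover have "rec_nat b (\<lambda>m r. Suc r) a = a + b" for a b :: nat
    by (induction a) simp_all
  ultimately show ?thesis
    by (auto elim!: recursive_cong simp: numeral_2_eq_2 nth_tl)
qed

lemma recursive_pred: "recursive 1 (\<lambda>xs. xs ! 0 - 1)"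
proof -
  have "recursive (Suc 0) (\<lambda>xs. rec_nat 0 (\<lambda>m r. (m # r # tl xs) ! 0) (xs ! 0))"
    by (intro recursive_rec_nat recursive_nth recursive_const) simp_all
  moreover have "rec_nat 0 (\<lambda>m r. m) a = a - 1" for a :: nat
    by (cases a) simp_all
  ultimately show ?thesis
    by simp
qed

lemma recursive_diff: "recursive 2 (\<lambda>xs. xs ! 0 - xs ! 1)"
proof -
  have "recursive (Suc 1) (\<lambda>xs. rec_nat (tl xs ! 0) (\<lambda>m r. (m # r # tl xs) ! 1 - 1) (xs ! 0))"
    by (intro recursive_rec_nat recursive_nth recursive_comp1[OF recursive_pred]) simp_all
  moreover have "rec_nat b (\<lambda>m r. r - 1) a = b - a" for a b :: nat
    by (induction a) simp_all
  \<comment> \<open>The recursion runs over the first argument, here the subtrahend; the composition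
    below exchanges the two arguments.\<close>
  ultimately have "recursive 2 (\<lambda>xs. xs ! 1 - xs ! 0)"
    by (auto elim!: recursive_cong simp: numeral_2_eq_2 nth_tl)
  then show ?thesis
    by (rule recursive_comp2[where f = "\<lambda>a b. b - a"]) (simp_all add: recursive_nth)
qed

lemma recursive_triangle: "recursive 1 (\<lambda>xs. triangle (xs ! 0))"
proof -
  have "recursive (Suc 0) (\<lambda>xs. rec_nat 0 (\<lambda>m r. (m # r # tl xs) ! 1 + Suc ((m # r # tl xs) ! 0)) (xs ! 0))"
    by (intro recursive_rec_nat recursive_nth recursive_const recursive_Suc
        recursive_comp2[OF recursive_add]) simp_all
  moreover have "rec_nat 0 (\<lambda>m r. r + Suc m) a = triangle a" for a :: nat
    by (induction a) simp_all
  ultimately show ?thesis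
    by simp
qed

lemma recursive_prod_encode: "recursive 2 (\<lambda>xs. prod_encode (xs ! 0, xs ! 1))"
  unfolding prod_encode_def prod.case
  by (intro recursive_comp2[OF recursive_add] recursive_comp1[OF recursive_triangle] recursive_nth)
    simp_all

abbreviation pi1 :: "nat \<Rightarrow> nat" where "pi1 n \<equiv> fst (prod_decode n)"
abbreviation pi2 :: "nat \<Rightarrow> nat" where "pi2 n \<equiv> snd (prod_decode n)"

text \<open>The index of the Cantor diagonal containing \<open>n\<close>, that is, the least
  \<open>s\<close> with \<open>n < triangle (Suc s)\<close>, written as a vanishing truncated
  difference to suit minimization.\<close>

definition diagonal :: "nat \<Rightarrow> nat" where
  "diagonal n = (LEAST s. Suc n - triangle (Suc s) = 0)"

text \<open>The code \<open>triangle (a + b) + a\<close> lies below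
  \<open>triangle (Suc (a + b))\<close> and, since \<open>triangle\<close> is monotone, not below
  \<open>triangle (Suc s)\<close> for any smaller \<open>s\<close>.\<close>

lemma diagonal_prod_encode: "diagonal (prod_encode (a, b)) = a + b"
  unfolding diagonal_def
proof (rule Least_equality)
  show "Suc (prod_encode (a, b)) - triangle (Suc (a + b)) = 0"
    by (simp add: prod_encode_def)
  fix s assume s: "Suc (prod_encode (a, b)) - triangle (Suc s) = 0"
  have "mono triangle" by (intro mono_iff_le_Suc[THEN iffD2]) simp
  then have "triangle (Suc s) \<le> triangle (a + b)" if "s < a + b"
    using that by (intro monoD[of triangle]) simp_all
  with s show "a + b \<le> s"
    by (force simp: prod_encode_def not_le[symmetric])
qed

lemma recursive_diagonal: "recursive 1 (\<lambda>xs. diagonal (xs ! 0))"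
proof -
  have "recursive (Suc 1) (\<lambda>xs. Suc (xs ! 1) - triangle (Suc (xs ! 0)))"
    by (intro recursive_comp2[OF recursive_diff] recursive_comp1[OF recursive_triangle]
        recursive_Suc recursive_nth) simp_all
  moreover have "\<exists>s. Suc n - triangle (Suc s) = 0" for n
    by (rule exI[of _ n]) simp
  ultimately show ?thesis
    using recursive_Least[where n = 1 and F = "\<lambda>xs. Suc (xs ! 1) - triangle (Suc (xs ! 0))"]
    by (simp add: diagonal_def)
qed

text \<open>The codes on diagonal \<open>s\<close> start at \<open>triangle s\<close>, and the
  offset from there is the first component.\<close>

lemma pi1_eq: "pi1 n = n - triangle (diagonal n)"
proof -
  obtain a b where "n = prod_encode (a, b)" by (metis prod_decode_inverse surj_pair)
  then show ?thesis by (simp add: diagonal_prod_encode) (simp add: prod_encode_def)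
qed

lemma pi2_eq: "pi2 n = diagonal n - pi1 n"
proof -
  obtain a b where "n = prod_encode (a, b)" by (metis prod_decode_inverse surj_pair)
  then show ?thesis by (simp add: diagonal_prod_encode)
qed

lemma recursive_pi1: "recursive 1 (\<lambda>xs. pi1 (xs ! 0))"
  unfolding pi1_eq
  by (intro recursive_comp2[OF recursive_diff] recursive_comp1[OF recursive_triangle]
        recursive_comp1[OF recursive_diagonal] recursive_nth) simp_all

lemma recursive_pi2: "recursive 1 (\<lambda>xs. pi2 (xs ! 0))"
  unfolding pi2_eq
  by (intro recursive_comp2[OF recursive_diff] recursive_comp1[OF recursive_pi1]
        recursive_comp1[OF recursive_diagonal] recursive_nth) simp_all

section \<open>Computable functions of one coded argument\<close>

lemma computable_iff: "computable f \<longleftrightarrow> recursive 1 (\<lambda>xs. f (xs ! 0))"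
  unfolding computable_def recursive_def
  by (intro ex_cong1) (auto simp: length_Suc_conv)

lemma computable_comp: "computable f \<Longrightarrow> computable g \<Longrightarrow> computable (\<lambda>x. f (g x))"
  unfolding computable_iff by (rule recursive_comp1)

lemma computable_comp2:
  "recursive 2 (\<lambda>xs. f (xs ! 0) (xs ! 1)) \<Longrightarrow> computable g \<Longrightarrow> computable h \<Longrightarrow>
    computable (\<lambda>x. f (g x) (h x))"
  unfolding computable_iff by (rule recursive_comp2)

text \<open>Closure rules applied backwards, so that computability or decidability of a term follows
  its syntax.\<close>

named_theorems comp

lemma computable_id [comp]: "computable (\<lambda>x. x)"
  unfolding computable_iff by (rule recursive_nth) simp

lemma computable_const [comp]: "computable (\<lambda>x. c)"
  unfolding computable_iff by (rule recursive_const)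

lemma computable_Suc [comp]: "computable f \<Longrightarrow> computable (\<lambda>x. Suc (f x))"
  unfolding computable_iff by (rule recursive_Suc)

lemmas computable_add [comp] = computable_comp2[OF recursive_add]
lemmas computable_diff [comp] = computable_comp2[OF recursive_diff]
lemmas computable_prod_encode [comp] = computable_comp2[OF recursive_prod_encode]
lemmas computable_pi1 [comp] = computable_comp[OF computable_iff[THEN iffD2, OF recursive_pi1]]
lemmas computable_pi2 [comp] = computable_comp[OF computable_iff[THEN iffD2, OF recursive_pi2]]

text \<open>The step function has three arguments (counter, accumulator, parameter). Packing them
  into one code keeps nested recursions among unary functions.\<close>

lemma computable_rec_nat [comp]:
  assumes "computable g" "computable (\<lambda>z. h (pi1 z) (pi1 (pi2 z)) (pi2 (pi2 z)))" "computable t"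
  shows "computable (\<lambda>x. rec_nat (g x) (\<lambda>m r. h m r x) (t x))"
proof -
  have "recursive 3 (\<lambda>xs. prod_encode (xs ! 0, prod_encode (xs ! 1, xs ! 2)))"
    by (intro recursive_comp2[OF recursive_prod_encode] recursive_nth) simp_all
  from recursive_comp1[OF assms(2)[unfolded computable_iff] this]
  have "recursive (Suc (Suc 1)) (\<lambda>xs. h (xs ! 0) (xs ! 1) (xs ! 2))"
    by (simp add: numeral_3_eq_3)
  from recursive_rec_nat[OF assms(1)[unfolded computable_iff] this]
  have "recursive 2 (\<lambda>xs. rec_nat (g (xs ! 1)) (\<lambda>m r. h m r (xs ! 1)) (xs ! 0))"
    by (auto elim!: recursive_cong simp: numeral_2_eq_2 nth_tl)
  then show ?thesis
    by (rule computable_comp2[where f = "\<lambda>a b. rec_nat (g b) (\<lambda>m r. h m r b) a" and g = t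
          and h = "\<lambda>x. x"]) (fact assms computable_id)+
qed

section \<open>Decidable predicates\<close>

definition dec :: "(nat \<Rightarrow> bool) \<Rightarrow> bool" where
  "dec P \<longleftrightarrow> computable (\<lambda>x. of_bool (P x))"

lemma dec_eq [comp]: "computable f \<Longrightarrow> computable g \<Longrightarrow> dec (\<lambda>x. f x = g x)"
proof -
  assume "computable f" "computable g"
  then have "computable (\<lambda>x. 1 - ((f x - g x) + (g x - f x)))" by (intro comp)
  also have "(\<lambda>x. 1 - ((f x - g x) + (g x - f x))) = (\<lambda>x. of_bool (f x = g x))" by auto
  finally show ?thesis by (simp add: dec_def)
qed

lemma dec_less [comp]: "computable f \<Longrightarrow> computable g \<Longrightarrow> dec (\<lambda>x. f x < g x)"
proof -
  assume "computable f" "computable g"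
  then have "computable (\<lambda>x. 1 - (1 - (g x - f x)))" by (intro comp)
  also have "(\<lambda>x. 1 - (1 - (g x - f x))) = (\<lambda>x. of_bool (f x < g x))" by auto
  finally show ?thesis by (simp add: dec_def)
qed

lemma dec_not [comp]: "dec P \<Longrightarrow> dec (\<lambda>x. \<not> P x)"
proof -
  assume "dec P"
  then have "computable (\<lambda>x. 1 - of_bool (P x))" unfolding dec_def by (intro comp)
  also have "(\<lambda>x. 1 - of_bool (P x) :: nat) = (\<lambda>x. of_bool (\<not> P x))" by auto
  finally show ?thesis by (simp add: dec_def)
qed

lemma dec_conj [comp]: "dec P \<Longrightarrow> dec Q \<Longrightarrow> dec (\<lambda>x. P x \<and> Q x)"
proof -
  assume "dec P" "dec Q"
  then have "computable (\<lambda>x. (of_bool (P x) + of_bool (Q x)) - 1)"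
    unfolding dec_def by (intro comp)
  also have "(\<lambda>x. (of_bool (P x) + of_bool (Q x)) - 1 :: nat) = (\<lambda>x. of_bool (P x \<and> Q x))" by auto
  finally show ?thesis by (simp add: dec_def)
qed

lemma dec_disj [comp]: "dec P \<Longrightarrow> dec Q \<Longrightarrow> dec (\<lambda>x. P x \<or> Q x)"
  using dec_not[OF dec_conj[OF dec_not[of P] dec_not[of Q]]] by simp

text \<open>Recursion on the truth value: no iteration leaves \<open>g x\<close>, a single one
  replaces it by \<open>f x\<close>.\<close>

lemma computable_If [comp]:
  assumes "dec P" "computable f" "computable g"
  shows "computable (\<lambda>x. if P x then f x else g x)"
proof -
  have "computable (\<lambda>x. rec_nat (g x) (\<lambda>m r. f x) (of_bool (P x)))"
    using assms(1) by (intro comp assms computable_comp[OF assms(2)]) (simp add: dec_def)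
  also have "(\<lambda>x. rec_nat (g x) (\<lambda>m r. f x) (of_bool (P x))) = (\<lambda>x. if P x then f x else g x)"
    by auto
  finally show ?thesis .
qed

lemma dec_comp: "dec P \<Longrightarrow> computable f \<Longrightarrow> dec (\<lambda>x. P (f x))"
  unfolding dec_def by (rule computable_comp)

text \<open>The truth values are folded into one conjunction: for bits \<open>r\<close> and
  \<open>b\<close>, the number \<open>r + b - 1\<close> is their minimum.\<close>

lemma dec_all_less [comp]:
  assumes "dec (\<lambda>z. P (pi1 z) (pi2 z))" "computable t"
  shows "dec (\<lambda>x. \<forall>i<t x. P i x)"
proof -
  \<comment> \<open>The recursion step receives counter, accumulator and parameter; \<open>P\<close>
    has to skip the accumulator.\<close>
  have "dec (\<lambda>z. P (pi1 z) (pi2 (pi2 z)))"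
    using dec_comp[OF assms(1), of "\<lambda>z. prod_encode (pi1 z, pi2 (pi2 z))"] by (simp add: comp)
  then have "computable (\<lambda>x. rec_nat 1 (\<lambda>m r. r + of_bool (P m x) - 1) (t x))"
    using assms(2) unfolding dec_def by (intro comp)
  moreover have "rec_nat 1 (\<lambda>m r. r + of_bool (Q m) - 1) n = (of_bool (\<forall>i<n. Q i) :: nat)" for Q n
    by (induction n) (auto simp: less_Suc_eq)
  ultimately show ?thesis by (simp add: dec_def)
qed

lemma dec_ex_less [comp]:
  "dec (\<lambda>z. P (pi1 z) (pi2 z)) \<Longrightarrow> computable t \<Longrightarrow> dec (\<lambda>x. \<exists>i<t x. P i x)"
  using dec_not[OF dec_all_less[where P = "\<lambda>i x. \<not> P i x"], of t] dec_not by simp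

lemma computable_Least:
  assumes "dec (\<lambda>z. P (pi1 z) (pi2 z))" "\<And>x. \<exists>y. P y x"
  shows "computable (\<lambda>x. LEAST y. P y x)"
proof -
  have "recursive (Suc 1) (\<lambda>xs. of_bool (\<not> P (xs ! 0) (xs ! 1)))"
    using recursive_comp1[OF dec_not[OF assms(1), unfolded dec_def computable_iff]
        recursive_prod_encode] by (simp add: numeral_2_eq_2)
  from recursive_Least[OF this] assms(2) show ?thesis
    by (simp add: computable_iff)
qed

section \<open>Recursively enumerable predicates\<close>

text \<open>Projections of decidable relations, with the witness as first component, need no
  separate case for the empty set, unlike ranges of total functions.\<close>

definition re :: "(nat \<Rightarrow> bool) \<Rightarrow> bool" where
  "re P \<longleftrightarrow> (\<exists>Q. dec (\<lambda>z. Q (pi1 z) (pi2 z)) \<and> (\<forall>x. P x \<longleftrightarrow> (\<exists>y. Q y x)))"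

lemma dec_comp_pair:
  assumes "dec (\<lambda>z. Q (pi1 z) (pi2 z))" "computable f" "computable g"
  shows "dec (\<lambda>x. Q (f x) (g x))"
  using dec_comp[OF assms(1) computable_prod_encode[OF assms(2,3)]] by simp

lemma reI:
  assumes "dec (\<lambda>z. Q (pi1 z) (pi2 z))" "\<And>x. P x \<longleftrightarrow> (\<exists>y. Q y x)"
  shows "re P"
  using assms unfolding re_def by blast

lemma reE:
  assumes "re P"
  obtains Q where "dec (\<lambda>z. Q (pi1 z) (pi2 z))" "P = (\<lambda>x. \<exists>y. Q y x)"
proof -
  from assms obtain Q where "dec (\<lambda>z. Q (pi1 z) (pi2 z))" "\<And>x. P x \<longleftrightarrow> (\<exists>y. Q y x)"
    unfolding re_def by blast
  then show thesis by (intro that[of Q] ext)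
qed

text \<open>The analogue of \<open>comp\<close> for positive formulas: conjunction, disjunction,
  unbounded existence and bounded universal quantification, but no negation.\<close>

named_theorems recomp

lemma re_dec:
  assumes "dec P"
  shows "re P"
  by (rule reI[where Q = "\<lambda>y. P"]) (intro dec_comp[OF assms] comp, simp)

lemmas re_eq [recomp] = re_dec[OF dec_eq]
lemmas re_less [recomp] = re_dec[OF dec_less]

lemma re_ex [recomp]: 
  assumes "re (\<lambda>z. P (pi1 z) (pi2 z))" 
  shows "re (\<lambda>x. \<exists>y. P y x)"
proof -
  obtain Q where Q: "dec (\<lambda>z. Q (pi1 z) (pi2 z))"
      "\<And>z. P (pi1 z) (pi2 z) \<longleftrightarrow> (\<exists>y. Q y z)"
    using assms unfolding re_def by blast
  show ?thesis
  proof (rule reI)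
    \<comment> \<open>A single number codes both the witness for \<open>Q\<close> and the value of
      the quantified variable.\<close>
    show "dec (\<lambda>z. Q (pi1 (pi1 z)) (prod_encode (pi2 (pi1 z), pi2 z)))"
      by (intro dec_comp_pair[OF Q(1)] comp)
    show "(\<exists>y. P y x) \<longleftrightarrow> (\<exists>y. Q (pi1 y) (prod_encode (pi2 y, x)))" for x
      using Q(2)[of "prod_encode (_, x)"] by (simp, metis prod_encode_inverse fst_conv snd_conv)
  qed
qed

lemma re_conj [recomp]:
  assumes "re P" "re P'" 
  shows "re (\<lambda>x. P x \<and> P' x)"
proof -
  from assms obtain Q Q' where [simp]: "P = (\<lambda>x. \<exists>y. Q y x)" "P' = (\<lambda>x. \<exists>y. Q' y x)"
    and Q: "dec (\<lambda>z. Q (pi1 z) (pi2 z))" "dec (\<lambda>z. Q' (pi1 z) (pi2 z))"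
    by (elim reE)
  have "re (\<lambda>x. \<exists>y y'. Q y x \<and> Q' y' x)"
    by (intro re_ex re_dec comp Q[THEN dec_comp_pair])
  then show ?thesis by simp
qed

lemma re_disj [recomp]:
  assumes "re P" "re P'" 
  shows "re (\<lambda>x. P x \<or> P' x)"
proof -
  from assms obtain Q Q' where [simp]: "P = (\<lambda>x. \<exists>y. Q y x)" "P' = (\<lambda>x. \<exists>y. Q' y x)"
    and Q: "dec (\<lambda>z. Q (pi1 z) (pi2 z))" "dec (\<lambda>z. Q' (pi1 z) (pi2 z))"
    by (elim reE)
  have "re (\<lambda>x. \<exists>y. Q y x \<or> Q' y x)"
    by (intro re_ex re_dec comp Q[THEN dec_comp_pair])
  then show ?thesis by (simp add: ex_disj_distrib)
qed

lemma re_comp: "re P \<Longrightarrow> computable f \<Longrightarrow> re (\<lambda>x. P (f x))"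
proof -
  assume "re P" and f: "computable f"
  then obtain Q where Q: "dec (\<lambda>z. Q (pi1 z) (pi2 z))" "P = (\<lambda>x. \<exists>y. Q y x)" by (elim reE)
  show ?thesis
    unfolding Q(2) by (intro re_ex re_dec Q(1)[THEN dec_comp_pair] comp computable_comp[OF f])
qed

lemma re_comp_pair:
  assumes "re (\<lambda>z. P (pi1 z) (pi2 z))" "computable f" "computable g"
  shows "re (\<lambda>x. P (f x) (g x))"
  using re_comp[OF assms(1) computable_prod_encode[OF assms(2,3)]] by simp

lemma re_comp_triple:
  assumes "re (\<lambda>z. P (pi1 z) (pi1 (pi2 z)) (pi2 (pi2 z)))"
    "computable f" "computable g" "computable h"
  shows "re (\<lambda>x. P (f x) (g x) (h x))"
  using re_comp[OF assms(1) computable_prod_encode[OF assms(2) computable_prod_encode[OF assms(3,4)]]]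
  by simp

text \<open>Finitely many searches succeed within a common bound.\<close>

lemma re_all_less [recomp]:
  assumes "re (\<lambda>z. P (pi1 z) (pi2 z))" "computable t"
  shows "re (\<lambda>x. \<forall>i<t x. P i x)"
proof -
  from assms(1) obtain Q where Q: "dec (\<lambda>z. Q (pi1 z) (pi2 z))"
      "\<And>z. P (pi1 z) (pi2 z) \<longleftrightarrow> (\<exists>y. Q y z)"
    unfolding re_def by blast
  have P: "P i x \<longleftrightarrow> (\<exists>y. Q y (prod_encode (i, x)))" for i x
    using Q(2)[of "prod_encode (i, x)"] by simp
  have *: "(\<forall>i<n. P i x) \<longleftrightarrow> (\<exists>b. \<forall>i<n. \<exists>y<b. Q y (prod_encode (i, x)))" for n x
  proof
    assume "\<forall>i<n. P i x"
    then obtain y where y: "\<And>i. i < n \<Longrightarrow> Q (y i) (prod_encode (i, x))" unfolding P by metis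
    \<comment> \<open>The successor of the sum of all witnesses is the common strict bound.\<close>
    have "y i < Suc (\<Sum>i<n. y i)" if "i < n" for i
      using that by (simp add: less_Suc_eq_le member_le_sum)
    with y show "\<exists>b. \<forall>i<n. \<exists>y<b. Q y (prod_encode (i, x))" by blast
  qed (auto simp: P)
  show ?thesis
    unfolding * by (intro re_ex re_dec comp Q(1)[THEN dec_comp_pair] computable_comp[OF assms(2)])
qed

text \<open>Search in parallel for a witness of either alternative.\<close>

lemma dec_if_re_co_re:
  assumes "re P" "re (\<lambda>x. \<not> P x)"
  shows "dec P"
proof -
  from assms obtain Q Q' where Q: "dec (\<lambda>z. Q (pi1 z) (pi2 z))" "dec (\<lambda>z. Q' (pi1 z) (pi2 z))"
    and P: "\<And>x. P x \<longleftrightarrow> (\<exists>y. Q y x)" "\<And>x. \<not> P x \<longleftrightarrow> (\<exists>y. Q' y x)"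
    unfolding re_def by blast
  define y where "y x = (LEAST y. Q y x \<or> Q' y x)" for x
  have ex: "\<exists>y. Q y x \<or> Q' y x" for x using P by blast
  have "computable y"
    unfolding y_def by (intro computable_Least ex comp Q)
  then have "dec (\<lambda>x. Q (y x) x)" by (intro dec_comp_pair[OF Q(1)] comp)
  \<comment> \<open>If \<open>Q\<close> fails at the witness found, then \<open>Q'\<close> holds
    there, which excludes \<open>P x\<close>.\<close>
  moreover have "Q (y x) x \<longleftrightarrow> P x" for x
    using LeastI_ex[OF ex, of x, folded y_def] P by blast
  ultimately show ?thesis by simp
qed

section \<open>Operations on codes of words\<close>

text \<open>A nonempty list has code \<open>Suc (prod_encode (head, code of tail))\<close>, so
  \<open>pi2 (r - 1)\<close> is the tail. The empty list has code 0 and stays 0 under further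
  steps.\<close>

definition code_drop :: "nat \<Rightarrow> nat \<Rightarrow> nat" where
  "code_drop c i = rec_nat c (\<lambda>_ r. pi2 (r - 1)) i"

definition code_nth :: "nat \<Rightarrow> nat \<Rightarrow> nat" where
  "code_nth c i = pi1 (code_drop c i - 1)"

text \<open>The list coded by \<open>u\<close> has length at most \<open>u\<close>, so \<open>u\<close> iterations suffice to prepend its
  entries, starting from the last one.\<close>

definition code_append :: "nat \<Rightarrow> nat \<Rightarrow> nat" where
  "code_append u v = rec_nat v (\<lambda>n r. if code_drop u (u - Suc n) = 0 then r
     else Suc (prod_encode (code_nth u (u - Suc n), r))) u"

lemma prod_decode_0: "prod_decode 0 = (0, 0)"
  by (simp add: prod_decode_def prod_decode_aux.simps)

lemma code_drop_list_encode: "code_drop (list_encode xs) i = list_encode (drop i xs)"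
proof (induction i)
  case (Suc i)
  have "pi2 (list_encode ys - 1) = list_encode (tl ys)" for ys
    by (cases ys) (simp_all add: prod_decode_0)
  with Suc show ?case by (simp add: code_drop_def drop_Suc tl_drop)
qed (simp add: code_drop_def)

lemma code_nth_list_encode: "i < length xs \<Longrightarrow> code_nth (list_encode xs) i = xs ! i"
  by (simp add: code_nth_def code_drop_list_encode Cons_nth_drop_Suc[symmetric])

lemma length_le_list_encode: "length xs \<le> list_encode xs"
proof (induction xs)
  case (Cons x xs)
  then show ?case using le_prod_encode_2[of "list_encode xs" x] by simp
qed simp

lemma code_append_list_encode:
  "code_append (list_encode xs) (list_encode ys) = list_encode (xs @ ys)"
proof -
  let ?u = "list_encode xs"
  \<comment> \<open>Loop invariant: after \<open>n\<close> iterations the entries from position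
    \<open>?u - n\<close> on have been prepended. A dropped code of 0 signals a position past the
    end, where nothing is added.\<close>
  have "rec_nat (list_encode ys) (\<lambda>n r. if code_drop ?u (?u - Suc n) = 0 then r
      else Suc (prod_encode (code_nth ?u (?u - Suc n), r))) n = list_encode (drop (?u - n) xs @ ys)"
    if "n \<le> ?u" for n
    using that
  proof (induction n)
    case 0
    then show ?case using length_le_list_encode[of xs] by simp
  next
    case (Suc n)
    define i where "i = ?u - Suc n"
    then have i: "?u - n = Suc i" using Suc.prems by simp
    show ?case
    proof (cases "i < length xs")
      case True
      then have "drop i xs = xs ! i # drop (Suc i) xs" by (simp add: Cons_nth_drop_Suc)
      with Suc True show ?thesis
        by (simp add: i i_def[symmetric] code_drop_list_encode code_nth_list_encode)
    next
      case False
      with Suc show ?thesis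
        by (simp add: i i_def[symmetric] code_drop_list_encode)
    qed
  qed
  from this[of ?u] show ?thesis by (simp add: code_append_def)
qed

lemma computable_code_drop [comp]:
  "computable f \<Longrightarrow> computable g \<Longrightarrow> computable (\<lambda>x. code_drop (f x) (g x))"
  unfolding code_drop_def by (intro comp)

lemma computable_code_nth [comp]:
  "computable f \<Longrightarrow> computable g \<Longrightarrow> computable (\<lambda>x. code_nth (f x) (g x))"
  unfolding code_nth_def by (intro comp)

lemma computable_code_append [comp]:
  assumes "computable f" "computable g"
  shows "computable (\<lambda>x. code_append (f x) (g x))"
  unfolding code_append_def by (intro comp assms computable_comp[OF assms(1)])

text \<open>This turns quantification over finite sequences into quantification over
  numbers.\<close>

lemma ex_code_nth: "\<exists>c. \<forall>i<n. code_nth c i = f i"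
  using code_nth_list_encode[of _ "map f [0..<n]"] by (intro exI) auto

definition word_of :: "nat \<Rightarrow> word" where
  "word_of = inv_into UNIV word_code"

lemma word_of_word_code [simp]: "word_of (word_code w) = w"
  using bij_word_code by (simp add: word_of_def bij_is_inj)

lemma word_code_word_of [simp]: "word_code (word_of n) = n"
  using bij_word_code by (simp add: word_of_def bij_is_surj surj_f_inv_f)

lemma bij_word_of: "bij word_of"
  using bij_word_code by (simp add: word_of_def bij_imp_bij_inv)

lemma word_of_eq_iff: "word_of n = w \<longleftrightarrow> n = word_code w"
  by auto

lemma word_of_code_append: "word_of (code_append a b) = word_of a @ word_of b"
proof -
  have "code_append (word_code u) (word_code v) = word_code (u @ v)" for u v
    by (simp add: word_code_def code_append_list_encode)
  from this[of "word_of a" "word_of b"] show ?thesis by simp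
qed

text \<open>A chain of steps is a coded finite sequence whose consecutive entries are related. The
  first argument of \<open>S\<close> is a parameter kept fixed along the chain, so the search is
  uniform in it.\<close>

lemma re_rtranclp:
  fixes d :: "nat \<Rightarrow> 'a"
  assumes "bij d" "re (\<lambda>z. S (pi1 z) (d (pi1 (pi2 z))) (d (pi2 (pi2 z))))"
  shows "re (\<lambda>z. (S (pi1 z))\<^sup>*\<^sup>* (d (pi1 (pi2 z))) (d (pi2 (pi2 z))))"
proof -
  have *: "(S w)\<^sup>*\<^sup>* (d x) (d y) \<longleftrightarrow> (\<exists>n c. code_nth c 0 = x \<and> code_nth c n = y \<and>
      (\<forall>i<n. S w (d (code_nth c i)) (d (code_nth c (Suc i)))))" (is "_ \<longleftrightarrow> ?R") for w x y
  proof -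
    have "?R" if "(S w)\<^sup>*\<^sup>* (d x) (d y)"
    proof -
      from that obtain n f where f: "f 0 = d x" "f n = d y" "\<And>i. i < n \<Longrightarrow> S w (f i) (f (Suc i))"
        unfolding rtranclp_power relpowp_fun_conv by blast
      obtain c where c: "\<And>i. i < Suc n \<Longrightarrow> code_nth c i = inv_into UNIV d (f i)"
        using ex_code_nth[of "Suc n" "\<lambda>i. inv_into UNIV d (f i)"] by blast
      have "\<And>a. inv_into UNIV d (d a) = a" "\<And>b. d (inv_into UNIV d b) = b"
        using \<open>bij d\<close> by (simp_all add: bij_is_inj bij_is_surj surj_f_inv_f)
      with f c show ?R by (intro exI[of _ n] exI[of _ c]) auto
    qed
    moreover have "(S w)\<^sup>*\<^sup>* (d x) (d y)" if ?R
    proof -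
      from that obtain n c where "code_nth c 0 = x" "code_nth c n = y"
        "\<forall>i<n. S w (d (code_nth c i)) (d (code_nth c (Suc i)))" by blast
      then show ?thesis
        unfolding rtranclp_power relpowp_fun_conv
        by (intro exI[of _ n] exI[of _ "\<lambda>i. d (code_nth c i)"]) simp
    qed
    ultimately show ?thesis by blast
  qed
  show ?thesis
    unfolding * by (intro recomp comp re_comp_triple[OF assms(2)])
qed

section \<open>Presented groups as words modulo relators\<close>

text \<open>Only insertions are elementary moves; the equivalence closure supplies the
  deletions.\<close>

inductive insertion :: "word set \<Rightarrow> word \<Rightarrow> word \<Rightarrow> bool" for R where
  insert_relator: "r \<in> R \<Longrightarrow> insertion R (p @ q) (p @ r @ q)"
| insert_cancelling: "insertion R (p @ q) (p @ [x, flip x] @ q)"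

abbreviation pres_eq :: "word set \<Rightarrow> word \<Rightarrow> word \<Rightarrow> bool" where
  "pres_eq R \<equiv> equivclp (insertion R)"

lemma insertion_iff:
  "insertion R u v \<longleftrightarrow>
    (\<exists>p q r. (r \<in> R \<or> (\<exists>x. r = [x, flip x])) \<and> u = p @ q \<and> v = p @ r @ q)"
  unfolding insertion.simps by blast

lemmas insert_cancelling_Cons = insert_cancelling[of R p q x for R p q x, simplified]

lemma pres_eq_if_insertion: "insertion R u v \<Longrightarrow> pres_eq R u v"
  by (rule r_into_equivclp)

lemma insertion_context: "insertion R u v \<Longrightarrow> insertion R (p @ u @ q) (p @ v @ q)"
proof (induction rule: insertion.induct)
  case (insert_relator r p' q')
  then show ?case using insertion.insert_relator[of r R "p @ p'" "q' @ q"] by simp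
next
  case (insert_cancelling p' q' x)
  show ?case using insertion.insert_cancelling[of R "p @ p'" "q' @ q" x] by simp
qed

lemma pres_eq_context: "pres_eq R u v \<Longrightarrow> pres_eq R (p @ u @ q) (p @ v @ q)"
proof (induction rule: equivclp_induct)
  case (step y z)
  then have "insertion R (p @ y @ q) (p @ z @ q) \<or> insertion R (p @ z @ q) (p @ y @ q)"
    using insertion_context by blast
  then show ?case
    using step.IH equivclp_trans r_into_equivclp equivclp_sym by metis
qed simp

lemma pres_eq_append: "pres_eq R u u' \<Longrightarrow> pres_eq R v v' \<Longrightarrow> pres_eq R (u @ v) (u' @ v')"
  using pres_eq_context[of R u u' "[]" v] pres_eq_context[of R v v' u' "[]"]
  by (auto intro: equivclp_trans)

lemma pres_eq_if_free_eq: "free_eq u v \<Longrightarrow> pres_eq R u v"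
proof (induction rule: free_eq.induct)
  case (free_eq_cancel u x v)
  show ?case using pres_eq_if_insertion[OF insert_cancelling] by (rule equivclp_sym)
qed (auto intro: equivclp_sym equivclp_trans)

lemma pres_eq_relator: "r \<in> R \<Longrightarrow> pres_eq R r []"
  using pres_eq_if_insertion[OF insert_relator[of r R "[]" "[]"]] by (simp add: equivclp_sym)

lemma pres_eq_mono:
  assumes "pres_eq R u v" "R \<subseteq> R'"
  shows "pres_eq R' u v"
  using assms(1)
proof (induction rule: equivclp_induct)
  case (step y z)
  have "insertion R' y z" if "insertion R y z" for y z
    using that assms(2) by cases (auto intro: insert_relator insert_cancelling_Cons)
  with step.hyps(2) have "pres_eq R' y z" by (metis r_into_equivclp equivclp_sym)
  with step.IH show ?case by (rule equivclp_trans)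
qed simp

text \<open>An insertion of \<open>w\<close> can be simulated in context by a derivation of
  \<open>w\<close> from the empty word, so a relator that is already trivial changes
  nothing.\<close>

lemma pres_eq_insertI:
  assumes "pres_eq R w []" "pres_eq (insert w R) u v"
  shows "pres_eq R u v"
  using assms(2)
proof (induction rule: equivclp_induct)
  case (step y z)
  have "pres_eq R y z" if "insertion (insert w R) y z" for y z
    using that
  proof (cases rule: insertion.cases)
    case (insert_relator r p q)
    then have "pres_eq R r []" using assms(1) pres_eq_relator by auto
    from pres_eq_context[OF this, of p q] show ?thesis
      using insert_relator by (simp add: equivclp_sym)
  next
    case (insert_cancelling p q x)
    then show ?thesis using pres_eq_if_insertion[OF insertion.insert_cancelling] by simp
  qed
  then have "pres_eq R y z" using step.hyps(2) equivclp_sym by metis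
  with step.IH show ?case by (rule equivclp_trans)
qed simp

section \<open>Cosets of the relator closure and derivability\<close>

abbreviation relator_closure :: "word set \<Rightarrow> word set set" where
  "relator_closure R \<equiv> normal_closure free_group (free_class ` R)"

lemma carrier_free_group: "carrier free_group = range free_class"
  and one_free_group: "\<one>\<^bsub>free_group\<^esub> = free_class []"
  by (simp_all add: free_group_def)

lemma free_class_in_carrier [simp]: "free_class u \<in> carrier free_group"
  unfolding carrier_free_group by (rule rangeI)

lemma inv_free_class: "inv\<^bsub>free_group\<^esub> (free_class u) = free_class (rev (map flip u))"
  by (rule group.inv_equality[OF group_free_group])
    (simp_all add: free_class_in_carrier mult_free_class one_free_group free_class_eq_iff free_eq_flip)

lemma relator_closure_normal: "relator_closure R \<lhd> free_group"
  by (rule group.normal_normal_closure[OF group_free_group]) (auto simp: carrier_free_group)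

lemma free_class_relator: "r \<in> R \<Longrightarrow> free_class r \<in> relator_closure R"
  by (auto simp: normal_closure_def)

lemma word_value_append:
  "word_value R (u @ v) = word_value R u \<otimes>\<^bsub>presented_group R\<^esub> word_value R v"
  unfolding word_value_def presented_group_def
  by (simp add: FactGroup_def normal.rcos_sum[OF relator_closure_normal] carrier_free_group
      mult_free_class)

lemma carrier_presented_group: "carrier (presented_group R) = range (word_value R)"
  by (auto simp: presented_group_def FactGroup_def RCOSETS_def word_value_def carrier_free_group)

lemma word_value_closed [simp]: "word_value R u \<in> carrier (presented_group R)"
  by (simp add: carrier_presented_group)

text \<open>The value of the empty word is idempotent, and the only idempotent of a group is the
  identity.\<close>

lemma word_value_Nil: "word_value R [] = \<one>\<^bsub>presented_group R\<^esub>"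
proof -
  interpret group "presented_group R" by (rule group_presented_group)
  show ?thesis using word_value_append[of R "[]" "[]"] by (simp add: l_cancel_one)
qed

lemma word_value_cong_free_eq: "free_eq u v \<Longrightarrow> word_value R u = word_value R v"
  by (simp add: word_value_def free_class_eq_iff[symmetric])

lemma word_value_relator: "r \<in> R \<Longrightarrow> word_value R r = \<one>\<^bsub>presented_group R\<^esub>"
proof -
  assume "r \<in> R"
  interpret normal "relator_closure R" free_group by (rule relator_closure_normal)
  from \<open>r \<in> R\<close> show ?thesis
    by (simp add: word_value_def presented_group_def FactGroup_def coset_join2 subgroup_axioms
        free_class_relator carrier_free_group)
qed

lemma flip_inverse: "word_value R (rev (map flip u)) = inv\<^bsub>presented_group R\<^esub> word_value R u"
proof -
  interpret group "presented_group R" by (rule group_presented_group)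
  show ?thesis
    by (rule inv_equality[symmetric])
      (simp_all add: word_value_append[symmetric] word_value_Nil[symmetric]
        word_value_cong_free_eq free_eq_flip)
qed

lemma word_value_eq_if_pres_eq: "pres_eq R u v \<Longrightarrow> word_value R u = word_value R v"
proof (induction rule: equivclp_induct)
  case (step y z)
  interpret group "presented_group R" by (rule group_presented_group)
  have "word_value R y = word_value R z" if "insertion R y z" for y z
    using that
  proof (cases rule: insertion.cases)
    case (insert_relator r p q)
    then show ?thesis by (simp add: word_value_append word_value_relator)
  next
    case (insert_cancelling p q x)
    show ?thesis
      unfolding insert_cancelling
      by (rule word_value_cong_free_eq, rule free_eq_sym, rule free_eq_cancel)
  qed
  with step show ?case by metis
qed simp

text \<open>The classes of the words equivalent to the empty word form a normal subgroup, which
  therefore contains the normal closure of the relators.\<close>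

lemma pres_eq_Nil_if_relator_closure:
  assumes "free_class u \<in> relator_closure R"
  shows "pres_eq R u []"
proof -
  define N where "N = free_class ` {u. pres_eq R u []}"
  have flip: "pres_eq R (rev (map flip u) @ u) []" "pres_eq R (u @ rev (map flip u)) []" for u
  proof -
    show "pres_eq R (rev (map flip u) @ u) []" for u by (rule pres_eq_if_free_eq[OF free_eq_flip])
    \<comment> \<open>The right inverse law is the left one for the formal inverse of
      \<open>u\<close>, because \<open>flip\<close> is an involution.\<close>
    from this[of "rev (map flip u)"] have "pres_eq R (map (flip \<circ> flip) u @ rev (map flip u)) []"
      by (simp add: rev_map)
    moreover have "flip \<circ> flip = id"
    proof
      show "(flip \<circ> flip) x = id x" for x by (cases x) auto
    qed
    ultimately show "pres_eq R (u @ rev (map flip u)) []" by simp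
  qed
  have "subgroup N free_group"
  proof (rule group.subgroupI[OF group_free_group])
    show "N \<subseteq> carrier free_group" by (auto simp: N_def)
    have "free_class [] \<in> N" by (simp add: N_def)
    then show "N \<noteq> {}" by blast
    fix a assume "a \<in> N"
    then obtain u where u: "a = free_class u" "pres_eq R u []" by (auto simp: N_def)
    have "pres_eq R (rev (map flip u)) (rev (map flip u) @ u)"
      using pres_eq_append[OF equivclp_refl equivclp_sym[OF u(2)]] by simp
    from equivclp_trans[OF this flip(1)]
    show "inv\<^bsub>free_group\<^esub> a \<in> N" by (auto simp: u inv_free_class N_def)
  next
    fix a b assume "a \<in> N" "b \<in> N"
    then obtain u v where "a = free_class u" "pres_eq R u []" "b = free_class v" "pres_eq R v []"
      by (auto simp: N_def)
    then show "a \<otimes>\<^bsub>free_group\<^esub> b \<in> N"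
      using pres_eq_append[of R u "[]" v "[]"] by (auto simp: mult_free_class N_def)
  qed
  then have "N \<lhd> free_group"
  proof (rule group.normal_invI[OF group_free_group])
    fix x h assume "x \<in> carrier free_group" "h \<in> N"
    then obtain u v where uv: "x = free_class u" "h = free_class v" "pres_eq R v []"
      by (auto simp: N_def carrier_free_group)
    have "pres_eq R (u @ v @ rev (map flip u)) []"
      using equivclp_trans[OF pres_eq_context[OF uv(3), of u "rev (map flip u)"]] flip(2)[of u]
      by simp
    then show "x \<otimes>\<^bsub>free_group\<^esub> h \<otimes>\<^bsub>free_group\<^esub> inv\<^bsub>free_group\<^esub> x \<in> N"
      by (auto simp: uv inv_free_class mult_free_class N_def)
  qed
  moreover have "free_class ` R \<subseteq> N" by (auto simp: N_def pres_eq_relator)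
  ultimately have "relator_closure R \<subseteq> N" by (auto simp: normal_closure_def)
  with assms obtain v where "free_class u = free_class v" "pres_eq R v []" by (auto simp: N_def)
  then show ?thesis
    by (auto simp: free_class_eq_iff intro: equivclp_trans pres_eq_if_free_eq)
qed

text \<open>If the cosets agree, then \<open>u\<close> is freely equal to some \<open>w @ v\<close>
  with \<open>w\<close> in the relator closure, and such a \<open>w\<close> reduces to the empty
  word. Equality in the group thereby becomes the existence of a finite derivation.\<close>

lemma word_value_eq_iff: "word_value R u = word_value R v \<longleftrightarrow> pres_eq R u v"
proof
  interpret N: normal "relator_closure R" free_group by (rule relator_closure_normal)
  assume "word_value R u = word_value R v"
  then have "free_class u \<in> relator_closure R #>\<^bsub>free_group\<^esub> free_class v"
    using N.rcos_self[of "free_class u"] N.subgroup_axioms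
    by (metis word_value_def free_class_in_carrier)
  then obtain h where "h \<in> relator_closure R" "free_class u = h \<otimes>\<^bsub>free_group\<^esub> free_class v"
    by (auto simp: r_coset_def)
  moreover from this(1) obtain w where "h = free_class w"
    using N.subset by (auto simp: carrier_free_group)
  ultimately have w: "pres_eq R w []" "free_eq u (w @ v)"
    by (auto simp: pres_eq_Nil_if_relator_closure mult_free_class free_class_eq_iff)
  from equivclp_trans[OF pres_eq_if_free_eq[OF w(2)] pres_eq_context[OF w(1), of "[]" v, simplified]]
  show "pres_eq R u v" .
qed (rule word_value_eq_if_pres_eq)

text \<open>Words are products of letters, and an inverse letter has the inverse value. Hence
  finitely many generator values would make a locally finite group finite.\<close>

lemma presented_group_eq_generate:
  "carrier (presented_group R) = generate (presented_group R) (range (\<lambda>i. word_value R [Gen i]))"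
    (is "_ = generate ?G ?A")
proof -
  interpret group ?G by (rule group_presented_group)
  have A: "?A \<subseteq> carrier ?G" by auto
  have letter: "word_value R [x] \<in> generate ?G ?A" for x
  proof (cases x)
    case (Gen i)
    then show ?thesis by (auto intro: generate.incl)
  next
    case (Inv i)
    then show ?thesis using flip_inverse[of R "[Gen i]"] by (auto intro: generate.inv)
  qed
  have "word_value R u \<in> generate ?G ?A" for u
  proof (induction u)
    case Nil
    show ?case by (simp add: word_value_Nil generate.one)
  next
    case (Cons x u)
    have "word_value R (x # u) = word_value R [x] \<otimes>\<^bsub>?G\<^esub> word_value R u"
      using word_value_append[of R "[x]" u] by simp
    with Cons letter[of x] show ?case by (simp add: generate.eng)
  qed
  with generate_incl[OF A] show ?thesis by (auto simp: carrier_presented_group)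
qed

text \<open>Adding a nontrivial element of a just infinite group to the relators gives a quotient by
  a nontrivial normal subgroup.\<close>

lemma finite_presented_group_insert:
  assumes "just_infinite (presented_group R)" "word_value R w \<noteq> \<one>\<^bsub>presented_group R\<^esub>"
  shows "finite (carrier (presented_group (insert w R)))"
proof -
  let ?G = "presented_group R" and ?H = "presented_group (insert w R)"
  \<comment> \<open>The natural projection, computed on an arbitrary representing word; monotonicity
    of derivability in the relators makes the choice irrelevant.\<close>
  define h where "h = word_value (insert w R) \<circ> inv_into UNIV (word_value R)"
  have h: "h (word_value R u) = word_value (insert w R) u" for u
  proof -
    have "word_value R (inv_into UNIV (word_value R) (word_value R u)) = word_value R u"
      by (rule f_inv_into_f) (rule rangeI)
    then show ?thesis by (auto simp: h_def word_value_eq_iff intro: pres_eq_mono)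
  qed
  interpret h: group_hom ?G ?H h
  proof (rule group_hom.intro[OF group_presented_group group_presented_group], unfold_locales)
    show "h \<in> hom ?G ?H"
      by (rule homI) (auto simp: carrier_presented_group h word_value_append[symmetric])
  qed
  have "h ` carrier ?G = carrier ?H"
    by (simp add: carrier_presented_group image_image h)
  then have onto: "(\<lambda>Y. the_elem (h ` Y)) ` carrier (?G Mod kernel ?G ?H h) = carrier ?H"
    by (rule h.FactGroup_onto)
  have "word_value R w \<in> kernel ?G ?H h"
    by (simp add: kernel_def h word_value_relator)
  with assms have "finite (carrier (?G Mod kernel ?G ?H h))"
    using h.normal_kernel unfolding just_infinite_def by blast
  then show ?thesis unfolding onto[symmetric] by (rule finite_imageI)
qed

text \<open>Right multiplication by an element of \<open>A\<close> is injective on the finite set \<open>V\<close>, hence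
  permutes it, so that \<open>V\<close> is closed under right multiplication by inverses as well.\<close>

lemma (in group) generate_subset_if_closed:
  assumes V: "finite V" "V \<subseteq> carrier G" "\<one> \<in> V" and A: "A \<subseteq> carrier G"
    and closed: "\<And>v a. v \<in> V \<Longrightarrow> a \<in> A \<Longrightarrow> v \<otimes> a \<in> V"
  shows "generate G A \<subseteq> V"
proof
  fix g assume g: "g \<in> generate G A"
  \<comment> \<open>Closure is claimed for every \<open>v\<close> so that the induction passes
    through products; at the identity it yields \<open>g\<close> itself.\<close>
  have "\<forall>v\<in>V. v \<otimes> g \<in> V"
    using g
  proof (induction rule: generate.induct)
    case one
    then show ?case using V(2) by auto
  next
    case (incl a)
    then show ?case using closed by blast
  next
    case (inv a)
    have "inj_on (\<lambda>v. v \<otimes> a) V"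
      using V(2) A inv by (intro inj_onI) (auto simp: subset_iff)
    moreover have "(\<lambda>v. v \<otimes> a) ` V \<subseteq> V" using closed inv by blast
    ultimately have *: "(\<lambda>v. v \<otimes> a) ` V = V" using V(1) by (simp add: endo_inj_surj)
    show ?case
    proof
      fix v assume "v \<in> V"
      with * obtain u where "u \<in> V" "v = u \<otimes> a" by blast
      with V(2) A inv show "v \<otimes> inv a \<in> V" by (auto simp: subset_iff m_assoc)
    qed
  next
    case (eng g h)
    have "g \<in> carrier G" "h \<in> carrier G" using eng.hyps generate_in_carrier[OF A] by auto
    with eng.IH V(2) show ?case by (metis m_assoc subsetD)
  qed
  moreover have "g \<in> carrier G" using g generate_in_carrier[OF A] by blast
  ultimately show "g \<in> V" using V(3) by force
qed

section \<open>The decision procedure\<close>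

text \<open>The code of the one-letter word \<open>[Gen i]\<close>; the letter code
  \<open>2 * i\<close> is written as a sum to match the closure rules.\<close>

definition code_gen :: "nat \<Rightarrow> nat" where
  "code_gen i = Suc (prod_encode (i + i, 0))"

lemma word_of_code_gen: "word_of (code_gen i) = [Gen i]"
  by (simp add: word_of_eq_iff word_code_def code_gen_def mult_2)

lemma computable_code_gen [comp]: "computable f \<Longrightarrow> computable (\<lambda>x. code_gen (f x))"
  unfolding code_gen_def by (intro comp)

lemma word_of_0: "word_of 0 = []"
  by (simp add: word_of_eq_iff word_code_def)

lemma word_of_inject: "word_of m = word_of n \<longleftrightarrow> m = n"
  using bij_word_of by (metis bij_pointE)

lemma ex_word_iff: "(\<exists>u. P u) \<longleftrightarrow> (\<exists>n. P (word_of n))"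
  using bij_word_of by (metis bij_pointE)

lemma re_mem_words:
  assumes "recursively_enumerable_words R"
  shows "re (\<lambda>n. word_of n \<in> R)"
proof (cases "R = {}")
  case True
  \<comment> \<open>The empty language has no enumerating function; an unsatisfiable inequality
    represents it.\<close>
  have "re (\<lambda>n. n < 0)" by (intro recomp comp)
  with True show ?thesis by simp
next
  case False
  then obtain e where e: "computable e" "word_code ` R = range e"
    using assms by (auto simp: recursively_enumerable_words_def)
  have "word_of n \<in> R \<longleftrightarrow> n \<in> word_code ` R" for n
    by (auto simp: image_iff) (metis word_code_word_of)
  then have "word_of n \<in> R \<longleftrightarrow> (\<exists>y. n = e y)" for n
    using e(2) by auto
  moreover have "re (\<lambda>n. \<exists>y. n = e y)"
    by (intro recomp comp computable_comp[OF e(1)])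
  ultimately show ?thesis by simp
qed

text \<open>A derivation is a finite chain of enumerable elementary moves. The additional relator is
  part of the input because the search for nontriviality works in the quotient by the given
  word.\<close>

lemma re_pres_eq:
  assumes "recursively_enumerable_words R"
  shows "re (\<lambda>z. pres_eq (insert (word_of (pi1 z)) R) (word_of (pi1 (pi2 z))) (word_of (pi2 (pi2 z))))"
proof -
  \<comment> \<open>\<open>Rel w r\<close> says that \<open>r\<close> codes an insertable word; the
    two explicit codes are those of \<open>[Gen i, Inv i]\<close> and
    \<open>[Inv i, Gen i]\<close>.\<close>
  define Rel where "Rel w r \<longleftrightarrow> r = w \<or> word_of r \<in> R \<or>
    (\<exists>i. r = Suc (prod_encode (i + i, Suc (prod_encode (Suc (i + i), 0)))) \<or>
         r = Suc (prod_encode (Suc (i + i), Suc (prod_encode (i + i, 0)))))" for w r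
  have Rel: "Rel w r \<longleftrightarrow> word_of r \<in> insert (word_of w) R \<or> (\<exists>x. word_of r = [x, flip x])" for w r
  proof -
    have "(\<exists>x. word_of r = [x, flip x]) \<longleftrightarrow> (\<exists>i. word_of r = [Gen i, Inv i] \<or> word_of r = [Inv i, Gen i])"
      by (metis flip.simps letter.exhaust)
    then show ?thesis
      by (simp add: Rel_def word_of_inject word_of_eq_iff[of r "[_, _]"] word_code_def mult_2)
  qed
  have ins: "insertion (insert (word_of w) R) (word_of a) (word_of b) \<longleftrightarrow>
      (\<exists>p q r. Rel w r \<and> a = code_append p q \<and> b = code_append p (code_append r q))" for w a b
    unfolding insertion_iff ex_word_iff Rel word_of_code_append[symmetric] word_of_inject ..
  have "re (\<lambda>z. Rel (pi1 z) (pi2 z))"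
    unfolding Rel_def by (intro recomp comp re_comp[OF re_mem_words[OF assms]])
  note Rel_re = re_comp_pair[OF this]
  have "re (\<lambda>z. symclp (insertion (insert (word_of (pi1 z)) R))
      (word_of (pi1 (pi2 z))) (word_of (pi2 (pi2 z))))"
    unfolding symclp_def ins by (intro recomp comp Rel_re)
  from re_rtranclp[where S = "\<lambda>w. symclp (insertion (insert (word_of w) R))", OF bij_word_of this]
  show ?thesis by (simp add: equivclp_def)
qed

text \<open>Taking the empty word as the additional relator leaves derivability unchanged.\<close>

lemma re_word_problem:
  assumes "recursively_enumerable_words R"
  shows "re (\<lambda>n. word_value R (word_of n) = \<one>\<^bsub>presented_group R\<^esub>)"
proof -
  have "pres_eq (insert [] R) u v \<longleftrightarrow> pres_eq R u v" for u v
    using pres_eq_insertI[of R "[]" u v] pres_eq_mono[of R u v "insert [] R"] by auto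
  moreover have "re (\<lambda>n. pres_eq (insert (word_of 0) R) (word_of n) (word_of 0))"
    by (intro re_comp_triple[OF re_pres_eq[OF assms]] comp)
  ultimately show ?thesis
    by (simp add: word_of_0 word_value_Nil[symmetric] word_value_eq_iff)
qed

text \<open>A certificate that the subgroup generated by the first \<open>k\<close> generators has at most \<open>m\<close>
  elements in the quotient by the word coded by \<open>w\<close>: the entries of \<open>c\<close> below \<open>m\<close> code words
  whose classes include the identity and are permuted by these generators.\<close>

definition small_certificate :: "word set \<Rightarrow> nat \<Rightarrow> nat \<Rightarrow> nat \<Rightarrow> nat \<Rightarrow> bool" where
  "small_certificate R w k m c \<longleftrightarrow>
     (\<exists>l. l < m \<and> pres_eq (insert (word_of w) R) [] (word_of (code_nth c l))) \<and>
     (\<forall>i<m. \<forall>j<k. \<exists>l. l < m \<and>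
        pres_eq (insert (word_of w) R) (word_of (code_nth c i) @ [Gen j]) (word_of (code_nth c l)))"

lemma re_small_certificate:
  assumes "recursively_enumerable_words R"
  shows "re (\<lambda>z. small_certificate R (pi1 z) (pi1 (pi2 z)) (pi1 (pi2 (pi2 z))) (pi2 (pi2 (pi2 z))))"
  unfolding small_certificate_def word_of_code_gen[symmetric] word_of_code_append[symmetric]
  unfolding word_of_0[symmetric] by (intro recomp comp re_comp_triple[OF re_pres_eq[OF assms]])

text \<open>For trivial \<open>w\<close> the additional relator changes nothing, so the certified
  words have at most \<open>m\<close> values in the group itself. These contain the identity and are
  closed under the generators, hence contain the generated subgroup.\<close>

lemma card_generate_le_if_small_certificate:
  assumes "small_certificate R w k m c" "word_value R (word_of w) = \<one>\<^bsub>presented_group R\<^esub>"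
  shows "card (generate (presented_group R) ((\<lambda>i. word_value R [Gen i]) ` {..<k})) \<le> m"
proof -
  define v where "v i = word_value R (word_of (code_nth c i))" for i
  interpret group "presented_group R" by (rule group_presented_group)
  have "pres_eq R (word_of w) []"
    using assms(2) by (simp add: word_value_Nil[symmetric] word_value_eq_iff)
  note eq = word_value_eq_if_pres_eq[OF pres_eq_insertI[OF this]]
  have "generate (presented_group R) ((\<lambda>i. word_value R [Gen i]) ` {..<k}) \<subseteq> v ` {..<m}"
  proof (rule generate_subset_if_closed)
    show "\<one>\<^bsub>presented_group R\<^esub> \<in> v ` {..<m}"
      using assms(1) eq unfolding small_certificate_def by (auto simp: v_def word_value_Nil[symmetric])
    fix x a assume "x \<in> v ` {..<m}" "a \<in> (\<lambda>i. word_value R [Gen i]) ` {..<k}"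
    then obtain i j where ij: "x = v i" "i < m" "a = word_value R [Gen j]" "j < k" by auto
    then obtain l where "l < m"
        "pres_eq (insert (word_of w) R) (word_of (code_nth c i) @ [Gen j]) (word_of (code_nth c l))"
      using assms(1) unfolding small_certificate_def by blast
    with ij eq show "x \<otimes>\<^bsub>presented_group R\<^esub> a \<in> v ` {..<m}"
      by (auto simp: v_def word_value_append[symmetric])
  qed (auto simp: v_def)
  then have "card (generate (presented_group R) ((\<lambda>i. word_value R [Gen i]) ` {..<k})) \<le>
      card (v ` {..<m})" by (intro card_mono) simp_all
  also have "\<dots> \<le> m" using card_image_le[of "{..<m}" v] by simp
  finally show ?thesis .
qed

text \<open>Representatives of all elements of the quotient form a certificate. Its size does not
  depend on \<open>k\<close>, so \<open>k\<close> can be chosen afterwards to make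
  \<open>f k\<close> larger.\<close>

lemma small_certificate_if_finite:
  assumes "finite (carrier (presented_group (insert (word_of w) R)))"
  shows "\<exists>c. small_certificate R w k (card (carrier (presented_group (insert (word_of w) R)))) c"
proof -
  let ?H = "presented_group (insert (word_of w) R)"
  let ?v = "word_value (insert (word_of w) R)"
  obtain e where e: "bij_betw e {..<card (carrier ?H)} (carrier ?H)"
    using ex_bij_betw_nat_finite[OF assms] by (auto simp: atLeast0LessThan)
  have "\<exists>u. e i = ?v u" if "i < card (carrier ?H)" for i
    using bij_betwE[OF e] that unfolding carrier_presented_group by blast
  then obtain u where u: "\<And>i. i < card (carrier ?H) \<Longrightarrow> e i = ?v (u i)" by metis
  obtain c where c: "\<And>i. i < card (carrier ?H) \<Longrightarrow> code_nth c i = word_code (u i)"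
    using ex_code_nth[of "card (carrier ?H)" "\<lambda>i. word_code (u i)"] by blast
  have "\<exists>l. l < card (carrier ?H) \<and> pres_eq (insert (word_of w) R) x (word_of (code_nth c l))" for x
  proof -
    have "?v x \<in> e ` {..<card (carrier ?H)}" using e by (simp add: bij_betw_def)
    then obtain l where "l < card (carrier ?H)" "?v x = e l" by auto
    with u c show ?thesis by (auto simp: word_value_eq_iff[symmetric])
  qed
  then show ?thesis unfolding small_certificate_def by blast
qed

lemma word_problem_decidable_iff_dec:
  "word_problem_decidable R \<longleftrightarrow> dec (\<lambda>n. word_value R (word_of n) = \<one>\<^bsub>presented_group R\<^esub>)"
proof -
  have "(\<forall>w. f (word_code w) = (if w \<in> L then 1 else 0)) \<longleftrightarrow> f = (\<lambda>n. of_bool (word_of n \<in> L))"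
    for f :: "nat \<Rightarrow> nat" and L
  proof
    assume *: "\<forall>w. f (word_code w) = (if w \<in> L then 1 else 0)"
    show "f = (\<lambda>n. of_bool (word_of n \<in> L))"
    proof
      show "f n = of_bool (word_of n \<in> L)" for n using *[rule_format, of "word_of n"] by simp
    qed
  qed simp
  from this[where L = "{w. word_value R w = \<one>\<^bsub>presented_group R\<^esub>}"] show ?thesis
    unfolding word_problem_decidable_def decidable_words_def dec_def by auto
qed

section \<open>From a growth bound to decidability\<close>

lemma word_problem_decidable_if_growth:
  assumes R: "recursively_enumerable_words R" "just_infinite (presented_group R)"
    and f: "computable f" "\<not> bdd_above (f ` {1..})"
      "\<And>k. k \<ge> 1 \<Longrightarrow> f k \<le> card (generate (presented_group R) ((\<lambda>i. word_value R [Gen i]) ` {..<k}))"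
  shows "word_problem_decidable R"
  unfolding word_problem_decidable_iff_dec
proof (rule dec_if_re_co_re)
  show "re (\<lambda>n. word_value R (word_of n) = \<one>\<^bsub>presented_group R\<^esub>)"
    by (rule re_word_problem[OF R(1)])
  \<comment> \<open>The bound on \<open>f\<close> is available from index 1 on, so the search uses
    \<open>Suc k\<close>.\<close>
  have "word_value R (word_of w) \<noteq> \<one>\<^bsub>presented_group R\<^esub> \<longleftrightarrow>
      (\<exists>k m c. m < f (Suc k) \<and> small_certificate R w (Suc k) m c)" (is "?L \<longleftrightarrow> ?R") for w
  proof
    assume ?L
    then have fin: "finite (carrier (presented_group (insert (word_of w) R)))"
      by (rule finite_presented_group_insert[OF R(2)])
    let ?m = "card (carrier (presented_group (insert (word_of w) R)))"
    have "\<exists>k\<ge>1. ?m < f k"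
    proof (rule ccontr)
      assume "\<not> (\<exists>k\<ge>1. ?m < f k)"
      then have "bdd_above (f ` {1..})" by (intro bdd_aboveI[of _ ?m]) (auto simp: not_less)
      with f(2) show False by contradiction
    qed
    then obtain k where "k \<ge> 1" "?m < f k" by blast
    moreover obtain c where "small_certificate R w k ?m c"
      using small_certificate_if_finite[OF fin] by blast
    ultimately show ?R by (cases k) auto
  next
    assume ?R
    then obtain k m c where "m < f (Suc k)" "small_certificate R w (Suc k) m c" by blast
    \<comment> \<open>For trivial \<open>w\<close> the certificate and the growth bound would give
      \<open>f (Suc k) \<le> m\<close>.\<close>
    with card_generate_le_if_small_certificate[of R w "Suc k" m c] f(3)[of "Suc k"] show ?L by force
  qed
  moreover have "re (\<lambda>w. \<exists>k m c. m < f (Suc k) \<and> small_certificate R w (Suc k) m c)"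
  proof -
    note cert = re_comp[OF re_small_certificate[OF R(1)] computable_prod_encode[OF _ 
        computable_prod_encode[OF _ computable_prod_encode]]]
    have "re (\<lambda>w. small_certificate R (p w) (q w) (r w) (s w))"
      if "computable p" "computable q" "computable r" "computable s" for p q r s
      using cert[OF that] by simp
    note cert = this
    show ?thesis by (intro recomp comp cert computable_comp[OF f(1)])
  qed
  ultimately show "re (\<lambda>n. word_value R (word_of n) \<noteq> \<one>\<^bsub>presented_group R\<^esub>)" by simp
qed

section \<open>From decidability to a growth bound\<close>

lemma growth_if_word_problem_decidable:
  fixes R :: "word set"
  defines "a \<equiv> (\<lambda>i. word_value R [Gen i])"
  assumes lf: "locally_finite (presented_group R)" and inf: "infinite (carrier (presented_group R))"
    and dec: "word_problem_decidable R"
  shows "\<exists>f. computable f \<and> (\<forall>k\<ge>1. f k \<ge> 1) \<and> mono_on {1..} f \<and>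
       \<not> bdd_above (f ` {1..}) \<and> (\<forall>k\<ge>1. card (generate (presented_group R) (a ` {..<k})) \<ge> f k)"
proof -
  let ?G = "presented_group R"
  interpret group ?G by (rule group_presented_group)
  have a [simp]: "a i \<in> carrier ?G" for i by (simp add: a_def)
  \<comment> \<open>Indices of first occurrences: every generator value is attained exactly once on
    \<open>I\<close>, so \<open>f k\<close> counts the distinct values among the first
    \<open>k\<close> generators.\<close>
  define I where "I = {i. \<forall>j<i. a i \<noteq> a j}"
  define f where "f k = card (I \<inter> {..<k})" for k
  have inj: "inj_on a I"
    by (intro linorder_inj_onI) (auto simp: I_def)
  have range: "range a = a ` I"
  proof -
    have "a i \<in> a ` I" for i
    proof (induction i rule: less_induct)
      case (less i)
      then show ?case by (cases "i \<in> I") (auto simp: I_def)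
    qed
    then show ?thesis by blast
  qed
  have "infinite I"
  proof
    assume "finite I"
    then have "finite (generate ?G (range a))"
      using lf unfolding locally_finite_def range by (auto simp: image_subset_iff)
    with inf show False by (simp add: presented_group_eq_generate a_def)
  qed
  have "computable f"
  proof -
    \<comment> \<open>Equality of two generators is the word problem for
      \<open>[Gen i, Inv j]\<close>.\<close>
    have eq: "a i = a j \<longleftrightarrow> word_value R (word_of (code_append (code_gen i)
        (Suc (prod_encode (Suc (j + j), 0))))) = \<one>\<^bsub>?G\<^esub>" for i j
    proof -
      have code: "word_of (Suc (prod_encode (Suc (j + j), 0))) = [Inv j]"
        by (simp add: word_of_eq_iff word_code_def mult_2)
      have "word_value R [Inv j] = inv\<^bsub>?G\<^esub> a j"
        using flip_inverse[of R "[Gen j]"] by (simp add: a_def)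
      moreover have "word_value R [Gen i] = a i" by (simp add: a_def)
      ultimately have "word_value R ([Gen i] @ [Inv j]) = a i \<otimes>\<^bsub>?G\<^esub> inv\<^bsub>?G\<^esub> a j"
        by (simp only: word_value_append)
      moreover have "a i = a j \<longleftrightarrow> a i \<otimes>\<^bsub>?G\<^esub> inv\<^bsub>?G\<^esub> a j = \<one>\<^bsub>?G\<^esub>"
        using inv_equality[of "a i" "inv\<^bsub>?G\<^esub> a j"] by auto
      ultimately show ?thesis
        by (simp only: word_of_code_append word_of_code_gen code)
    qed
    have "computable (\<lambda>k. rec_nat 0 (\<lambda>m r. if \<forall>j<m. a m \<noteq> a j then Suc r else r) k)"
      unfolding eq by (intro comp dec_comp[OF dec[unfolded word_problem_decidable_iff_dec]])
    also have "(\<lambda>k. rec_nat 0 (\<lambda>m r. if \<forall>j<m. a m \<noteq> a j then Suc r else r) k) = f"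
    proof
      show "rec_nat 0 (\<lambda>m r. if \<forall>j<m. a m \<noteq> a j then Suc r else r) k = f k" for k
        by (induction k) (auto simp: f_def I_def lessThan_Suc Int_insert_right)
    qed
    finally show ?thesis .
  qed
  moreover have "f k \<ge> 1" if "k \<ge> 1" for k
  proof -
    \<comment> \<open>The first generator is always a first occurrence, even if its value is
      trivial.\<close>
    have "0 \<in> I \<inter> {..<k}" using that by (simp add: I_def)
    then show ?thesis unfolding f_def by (metis One_nat_def Suc_leI card_gt_0_iff emptyE finite_Int finite_lessThan)
  qed
  moreover have "mono_on {1..} f"
    by (intro mono_onI) (auto simp: f_def intro!: card_mono)
  moreover have "\<not> bdd_above (f ` {1..})"
  proof
    assume "bdd_above (f ` {1..})"
    then obtain B where B: "\<And>k. k \<ge> 1 \<Longrightarrow> f k \<le> B" by (auto simp: bdd_above_def)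
    obtain J where J: "J \<subseteq> I" "finite J" "card J = Suc B"
      using infinite_arbitrarily_large[OF \<open>infinite I\<close>] by blast
    then have "J \<subseteq> I \<inter> {..<Suc (Max J)}" by (auto simp: less_Suc_eq_le)
    then have "card J \<le> f (Suc (Max J))" unfolding f_def by (intro card_mono) simp_all
    with B[of "Suc (Max J)"] J show False by simp
  qed
  moreover have "f k \<le> card (generate ?G (a ` {..<k}))" for k
  proof -
    have "f k = card (a ` (I \<inter> {..<k}))"
      unfolding f_def by (rule card_image[symmetric]) (rule inj_on_subset[OF inj], simp)
    also have "\<dots> \<le> card (generate ?G (a ` {..<k}))"
    proof (rule card_mono)
      \<comment> \<open>Local finiteness enters here: \<open>card\<close> is 0 on infinite sets, so
        monotonicity of \<open>card\<close> needs a finite subgroup.\<close>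
      show "finite (generate ?G (a ` {..<k}))"
        using lf unfolding locally_finite_def by (auto simp: image_subset_iff)
    qed (auto intro: generate.incl)
    finally show ?thesis .
  qed
  ultimately show ?thesis by (intro exI[of _ f]) simp
qed

theorem theorem5:
  fixes R :: "word set"
  assumes "recursively_enumerable_words R"
    and "locally_finite (presented_group R)"
    and "just_infinite (presented_group R)"
  shows "word_problem_decidable R \<longleftrightarrow>
    (\<exists>f :: nat \<Rightarrow> nat. computable f \<and> (\<forall>k\<ge>1. f k \<ge> 1) \<and> mono_on {1..} f \<and>
       \<not> bdd_above (f ` {1..}) \<and>
       (\<forall>k\<ge>1. card (generate (presented_group R) ((\<lambda>i. word_value R [Gen i]) ` {..<k})) \<ge> f k))"
proof
  assume "word_problem_decidable R"
  then show "\<exists>f :: nat \<Rightarrow> nat. computable f \<and> (\<forall>k\<ge>1. f k \<ge> 1) \<and> mono_on {1..} f \<and>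
       \<not> bdd_above (f ` {1..}) \<and>
       (\<forall>k\<ge>1. card (generate (presented_group R) ((\<lambda>i. word_value R [Gen i]) ` {..<k})) \<ge> f k)"
    using assms growth_if_word_problem_decidable unfolding just_infinite_def by blast
next
  assume "\<exists>f :: nat \<Rightarrow> nat. computable f \<and> (\<forall>k\<ge>1. f k \<ge> 1) \<and> mono_on {1..} f \<and>
       \<not> bdd_above (f ` {1..}) \<and>
       (\<forall>k\<ge>1. card (generate (presented_group R) ((\<lambda>i. word_value R [Gen i]) ` {..<k})) \<ge> f k)"
  then obtain f where "computable f" "\<not> bdd_above (f ` {1..})"
    "\<And>k. k \<ge> 1 \<Longrightarrow> f k \<le> card (generate (presented_group R) ((\<lambda>i. word_value R [Gen i]) ` {..<k}))"
    by auto
  then show "word_problem_decidable R"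
    by (rule word_problem_decidable_if_growth[OF assms(1,3)])
qed

end
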